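(* Let $\partial\mathbb{D}$ be (an arc of) the unit circle in the plane centered at the origin, and let $\varphi$ be a function that is holomorphically continuable into $\mathbb{C}^2$ near $\partial\mathbb{D}$. If $u(z,\zeta)$ is a solution to the Dirichlet problem $\Delta u=0$ near $\partial\mathbb{D}$, $u=\varphi$ on $\partial\mathbb{D}$, then $$v(z,\zeta)=v(z_0,\zeta_0)-\int_z^{z_0}\frac{u_1(\tau)}{\tau}\,d\tau-\int_\zeta^{\zeta_0}\frac{u_2(\xi)}{\xi}\,d\xi$$ is a solution to the Neumann problem $\Delta v=0$ near $\partial\mathbb{D}$, $\frac{\partial v}{\partial n}=\varphi$ on $\partial\mathbb{D}$. Here $u(z,\zeta)=u_1(z)+u_2(\zeta)$ is a harmonic function such that $u(z,\bar z)=\varphi$ on $\partial\mathbb{D}$.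
   Context: Functions $u(x,y)$, $v(x,y)$ defined near the arc are complexified by the change of variables $z=x+iy$, $\zeta=x-iy$, so that $u(z,\zeta)$, $v(z,\zeta)$ are considered for $(z,\zeta)\in\mathbb{C}^2$, with $\zeta=\bar z$ on $\mathbb{R}^2$; harmonicity means $\frac{\partial^2 v}{\partial z\,\partial\zeta}=0$. The function $u_1$ depends only on $z$ and $u_2$ only on $\zeta$. The point $(z_0,\zeta_0)$, with $\zeta_0=\bar z_0$, is a fixed base point, and $v(z_0,\zeta_0)$ is the (constant) value of $v$ there. By $n$ is denoted the outward normal to the unit circle. *)

theory Defs
  imports "HOL-Complex_Analysis.Complex_Analysis"
begin

text \<open>Proper subarcs may be open, half-open or closed; the whole circle is \<open>T = UNIV\<close>.\<close>

definition unit_circle_arc :: "complex set \<Rightarrow> bool" where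
  "unit_circle_arc \<Gamma> \<longleftrightarrow> (\<exists>T :: real set. is_interval T \<and> interior T \<noteq> {} \<and> \<Gamma> = cis ` T)"

text \<open>The real plane sits in \<open>\<complex>\<^sup>2\<close> (coordinates \<open>z = x + iy\<close>, \<open>\<zeta> = x - iy\<close>) as the set
  \<open>\<zeta> = cnj z\<close>.\<close>

definition real_points :: "complex set \<Rightarrow> (complex \<times> complex) set" where
  "real_points S = (\<lambda>z. (z, cnj z)) ` S"

text \<open>Holomorphy in two variables: the Frechet derivative exists and is complex linear.\<close>

definition holomorphic2_on :: "(complex \<times> complex \<Rightarrow> complex) \<Rightarrow> (complex \<times> complex) set \<Rightarrow> bool" where
  "holomorphic2_on f W \<longleftrightarrow>
     (\<forall>w\<in>W. \<exists>a b. (f has_derivative (\<lambda>(h, k). a * h + b * k)) (at w within W))"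

text \<open>In the coordinates \<open>z, \<zeta>\<close> the Laplacian is \<open>4 \<partial>\<^sup>2/\<partial>z\<partial>\<zeta>\<close>.\<close>

definition laplacian2 :: "(complex \<times> complex \<Rightarrow> complex) \<Rightarrow> complex \<times> complex \<Rightarrow> complex" where
  "laplacian2 f w = 4 * deriv (\<lambda>z. deriv (\<lambda>\<zeta>. f (z, \<zeta>)) (snd w)) (fst w)"

definition harmonic_near :: "complex set \<Rightarrow> (complex \<times> complex \<Rightarrow> complex) \<Rightarrow> bool" where
  "harmonic_near \<Gamma> f \<longleftrightarrow> (\<exists>W. open W \<and> real_points \<Gamma> \<subseteq> W \<and> holomorphic2_on f W \<and>
     (\<forall>w\<in>W. laplacian2 f w = 0))"

definition holomorphically_continuable :: "complex set \<Rightarrow> (complex \<Rightarrow> complex) \<Rightarrow> bool" where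
  "holomorphically_continuable \<Gamma> \<phi> \<longleftrightarrow> (\<exists>W F. open W \<and> real_points \<Gamma> \<subseteq> W \<and>
     holomorphic2_on F W \<and> (\<forall>z\<in>\<Gamma>. F (z, cnj z) = \<phi> z))"

definition dirichlet_solution ::
  "complex set \<Rightarrow> (complex \<Rightarrow> complex) \<Rightarrow> (complex \<times> complex \<Rightarrow> complex) \<Rightarrow> bool" where
  "dirichlet_solution \<Gamma> \<phi> u \<longleftrightarrow> harmonic_near \<Gamma> u \<and> (\<forall>z\<in>\<Gamma>. u (z, cnj z) = \<phi> z)"

text \<open>The directional derivative, along the real plane, in the direction \<open>n\<close>.\<close>

definition has_directional_derivative ::
  "(complex \<times> complex \<Rightarrow> complex) \<Rightarrow> complex \<Rightarrow> complex \<Rightarrow> complex \<Rightarrow> bool" where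
  "has_directional_derivative f n d z \<longleftrightarrow>
     ((\<lambda>t::real. f (z + of_real t * n, cnj (z + of_real t * n))) has_vector_derivative d) (at 0)"

text \<open>The outward unit normal to the unit circle at the point \<open>z\<close> is \<open>z\<close> itself.\<close>

definition neumann_solution ::
  "complex set \<Rightarrow> (complex \<Rightarrow> complex) \<Rightarrow> (complex \<times> complex \<Rightarrow> complex) \<Rightarrow> bool" where
  "neumann_solution \<Gamma> \<phi> v \<longleftrightarrow> harmonic_near \<Gamma> v \<and>
     (\<forall>z\<in>\<Gamma>. has_directional_derivative v z (\<phi> z) z)"

text \<open>The function
  \<open>v(z,\<zeta>) = v(z\<^sub>0,\<zeta>\<^sub>0) - \<integral>\<^sub>z\<^sup>z\<^sup>0 u\<^sub>1(\<tau>)/\<tau> d\<tau> - \<integral>\<^sub>\<zeta>\<^sup>\<zeta>\<^sup>0 u\<^sub>2(\<xi>)/\<xi> d\<xi>\<close> with \<open>\<zeta>\<^sub>0 = cnj z\<^sub>0\<close>, on \<open>W\<close>.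
  The paths run in \<open>U\<close> and in its mirror image. As \<open>U\<close> need not be simply connected the
  integrals may be multivalued, and \<open>v\<close> is any continuous branch; continuity prevents the choice
  of the paths from jumping between homotopy classes with different periods.\<close>

definition integral_branch ::
  "complex set \<Rightarrow> (complex \<Rightarrow> complex) \<Rightarrow> (complex \<Rightarrow> complex) \<Rightarrow> complex \<Rightarrow>
   (complex \<times> complex) set \<Rightarrow> (complex \<times> complex \<Rightarrow> complex) \<Rightarrow> bool" where
  "integral_branch U u1 u2 z0 W v \<longleftrightarrow> continuous_on W v \<and>
     (\<forall>(z, \<zeta>)\<in>W. \<exists>p q.
        valid_path p \<and> path_image p \<subseteq> U \<and> pathstart p = z \<and> pathfinish p = z0 \<and>
        valid_path q \<and> path_image q \<subseteq> cnj ` U \<and> pathstart q = \<zeta> \<and> pathfinish q = cnj z0 \<and>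
        v (z, \<zeta>) = v (z0, cnj z0) - contour_integral p (\<lambda>\<tau>. u1 \<tau> / \<tau>)
                                  - contour_integral q (\<lambda>\<xi>. u2 \<xi> / \<xi>))"

end

theory Submission imports Defs begin

text \<open>For a fixed endpoint the integrals along all paths in \<open>U\<close> form a countable set, so near each point a
  continuous branch \<open>v\<close> is \<open>F z + G \<zeta>\<close> with \<open>F' = u\<^sub>1(z)/z\<close> and \<open>G' = u\<^sub>2(\<zeta>)/\<zeta>\<close>. Such a sum is
  harmonic, and at \<open>|z| = 1\<close> its derivative along the normal \<open>z\<close> is
  \<open>z F'(z) + cnj z G'(cnj z) = u\<^sub>1(z) + u\<^sub>2(cnj z)\<close>. A branch exists near a proper arc because the arc
  has a simply connected neighbourhood inside \<open>U\<close>.\<close>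

section \<open>Countability of path integrals and the local form of a continuous branch\<close>

lemma complex_rational_approx:
  fixes w :: complex
  assumes "0 < e"
  shows "\<exists>q :: rat \<times> rat. cmod (w - Complex (of_rat (fst q)) (of_rat (snd q))) < e"
proof -
  obtain r where r: "Re w - e/2 < of_rat r" "of_rat r < Re w + e/2"
    using of_rat_dense[of "Re w - e/2" "Re w + e/2"] assms by auto
  obtain s where s: "Im w - e/2 < of_rat s" "of_rat s < Im w + e/2"
    using of_rat_dense[of "Im w - e/2" "Im w + e/2"] assms by auto
  have "cmod (w - Complex (of_rat r) (of_rat s)) < e"
    using cmod_le[of "w - Complex (of_rat r) (of_rat s)"] r s by (simp add: abs_if split: if_splits)
  then show ?thesis by (metis fst_conv snd_conv)
qed

text \<open>Two paths with the same rational samples on a fine enough grid are uniformly close,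
  hence have the same integral; and there are only countably many lists of samples.\<close>

lemma countable_contour_integrals:
  assumes "open U" "f holomorphic_on U"
  shows "countable {contour_integral p f | p. valid_path p \<and> path_image p \<subseteq> U \<and>
           pathstart p = a \<and> pathfinish p = b}"
proof -
  define V where "V = {contour_integral p f | p. valid_path p \<and> path_image p \<subseteq> U \<and>
           pathstart p = a \<and> pathfinish p = b}"
  define c :: "rat \<times> rat \<Rightarrow> complex" where "c = (\<lambda>q. Complex (of_rat (fst q)) (of_rat (snd q)))"
  \<comment> \<open>\<open>P\<close> collects discrete data that pin down the value
    \<open>v\<close>. Every path within \<open>4 / m\<close> of \<open>p\<close> with the same ends
    has the same integral, \<open>p\<close> varies by less than \<open>1 / m\<close> over times at
    most \<open>1 / n\<close> apart, and \<open>xs\<close> holds rational points within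
    \<open>1 / m\<close> of \<open>p\<close> at the grid times \<open>k / n\<close>. The 4 leaves
    room for the four errors of size \<open>1 / m\<close> that arise when two such paths are
    compared.\<close>
  define P where "P = (\<lambda>v n m xs p. valid_path p \<and> pathstart p = a \<and> pathfinish p = b \<and>
     contour_integral p f = v \<and> 0 < n \<and>
     (\<forall>g. valid_path g \<and> (\<forall>t\<in>{0..1}. cmod (g t - p t) < 4 / real m) \<and>
          pathstart g = a \<and> pathfinish g = b \<longrightarrow> contour_integral g f = v) \<and>
     (\<forall>s\<in>{0..1}. \<forall>t\<in>{0..1}. \<bar>s - t\<bar> \<le> 1 / real n \<longrightarrow> cmod (p s - p t) < 1 / real m) \<and>
     (\<forall>k\<le>n. cmod (p (real k / real n) - c (xs ! k)) < 1 / real m))"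
  have "\<exists>n m xs p. P v n m xs p" if "v \<in> V" for v
  proof -
    from that obtain p where p: "valid_path p" "path_image p \<subseteq> U" "pathstart p = a"
        "pathfinish p = b" "contour_integral p f = v"
      unfolding V_def by blast
    have pth: "path p" using p by (simp add: valid_path_imp_path)
    obtain d where d: "0 < d" and near: "\<And>g h. valid_path g \<Longrightarrow> valid_path h \<Longrightarrow>
        \<forall>t\<in>{0..1}. cmod (g t - p t) < d \<and> cmod (h t - p t) < d \<Longrightarrow>
        pathstart h = pathstart g \<Longrightarrow> pathfinish h = pathfinish g \<Longrightarrow>
        contour_integral h f = contour_integral g f"
      using contour_integral_nearby_ends[OF \<open>open U\<close> pth p(2)] assms(2) by metis
    obtain m :: nat where m: "0 < m" "4 / d < real m"
      using reals_Archimedean2[of "4/d"] d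
      by (metis divide_pos_pos gr_zeroI less_trans not_less_iff_gr_or_eq of_nat_0 zero_less_numeral)
    have m': "4 / real m < d" using m d by (simp add: field_simps)
    have "uniformly_continuous_on {0..1} p"
      using pth by (simp add: compact_uniformly_continuous path_def)
    then obtain e where e: "0 < e" and unif: "\<And>s t. s \<in> {0..1} \<Longrightarrow> t \<in> {0..1} \<Longrightarrow>
        \<bar>s - t\<bar> < e \<Longrightarrow> cmod (p s - p t) < 1 / real m"
      unfolding uniformly_continuous_on_def dist_norm using m
      by (metis divide_pos_pos of_nat_0_less_iff real_norm_def zero_less_one)
    obtain n0 where n0: "inverse (real (Suc n0)) < e" using reals_Archimedean[OF e] by auto
    define n where "n = Suc n0"
    have n: "0 < n" "1 / real n < e" using n0 by (auto simp: n_def inverse_eq_divide)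
    have "\<forall>k. \<exists>q. cmod (p (real k / real n) - c q) < 1 / real m"
      unfolding c_def using m complex_rational_approx by simp
    then obtain q where q: "\<And>k. cmod (p (real k / real n) - c (q k)) < 1 / real m" by metis
    have "P v n m (map q [0..<Suc n]) p"
      unfolding P_def
    proof (intro conjI allI impI ballI)
      fix g assume g: "valid_path g \<and> (\<forall>t\<in>{0..1}. cmod (g t - p t) < 4 / real m) \<and>
          pathstart g = a \<and> pathfinish g = b"
      show "contour_integral g f = v"
        using near[of p g] g p d m' by force
    next
      fix s t :: real assume "s \<in> {0..1}" "t \<in> {0..1}" "\<bar>s - t\<bar> \<le> 1 / real n"
      then show "cmod (p s - p t) < 1 / real m" using unif n by auto
    next
      fix k assume "k \<le> n"
      then have "map q [0..<Suc n] ! k = q k" by (simp del: upt_Suc)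
      then show "cmod (p (real k / real n) - c (map q [0..<Suc n] ! k)) < 1 / real m"
        using q by simp
    qed (use p n in auto)
    then show ?thesis by blast
  qed
  then obtain n m xs p where P: "\<And>v. v \<in> V \<Longrightarrow> P v (n v) (m v) (xs v) (p v)" by metis
  \<comment> \<open>The triples of two naturals and a list of pairs of rationals form a countable
    type, so injectivity of this encoding gives countability.\<close>
  have "inj_on (\<lambda>v. (n v, m v, xs v)) V"
  proof (rule inj_onI)
    fix v w assume vV: "v \<in> V" and wV: "w \<in> V"
      and eq: "(n v, m v, xs v) = (n w, m w, xs w)"
    define N where "N = n v"
    define M where "M = m v"
    have Pv: "P v N M (xs v) (p v)" and Pw: "P w N M (xs v) (p w)"
      using P[OF vV] P[OF wV] eq by (simp_all add: N_def M_def)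
    have "cmod (p w t - p v t) < 4 / real M" if t: "t \<in> {0..1}" for t
    proof -
      have N: "0 < N" using Pv by (simp add: P_def)
      \<comment> \<open>Time \<open>t\<close> is rounded down to the grid. For \<open>t = 1\<close>
        this gives \<open>k = N\<close>, which is why the sample lists have \<open>n + 1\<close>
        entries.\<close>
      define k where "k = nat \<lfloor>t * real N\<rfloor>"
      have k: "real k \<le> t * real N" "t * real N < real k + 1"
        using t N by (auto simp: k_def of_nat_nat)
      have "real k \<le> real N" using k t N
        by (smt (verit) atLeastAtMost_iff mult_left_le_one_le of_nat_0_le_iff)
      then have kN: "k \<le> N" by simp
      define s where "s = real k / real N"
      have s: "s \<in> {0..1}" using kN N by (simp add: s_def)
      have "t - s = (t * real N - real k) / real N" using N by (simp add: s_def field_simps)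
      then have "\<bar>t - s\<bar> \<le> 1 / real N" using k N by (simp add: divide_right_mono)
      then have "cmod (p v t - p v s) < 1 / real M" "cmod (p w t - p w s) < 1 / real M"
        using Pv Pw s t unfolding P_def by blast+
      moreover have "cmod (p v s - c (xs v ! k)) < 1 / real M"
          "cmod (p w s - c (xs v ! k)) < 1 / real M"
        using Pv Pw kN unfolding P_def s_def by blast+
      \<comment> \<open>The detour runs from \<open>p w t\<close> to the grid time, to the shared
        rational sample, to the other path at the grid time, and back to time
        \<open>t\<close>.\<close>
      moreover have "cmod (p w t - p v t) \<le> cmod (p w t - p w s) + cmod (p w s - c (xs v ! k))
          + cmod (p v s - c (xs v ! k)) + cmod (p v t - p v s)"
        using dist_triangle[of "p w t" "p v t" "p w s"] dist_triangle[of "p w s" "p v t" "p v s"]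
          dist_triangle3[of "p w s" "p v s" "c (xs v ! k)"]
        by (simp add: dist_norm norm_minus_commute)
      ultimately show ?thesis by linarith
    qed
    then have "contour_integral (p w) f = v" using Pv Pw unfolding P_def by blast
    then show "v = w" using Pw unfolding P_def by simp
  qed
  then show ?thesis unfolding V_def by (rule countableI')
qed

text \<open>A connected subset of a metric space with two distinct points is uncountable. Here this
  turns continuity of a branch into local constancy of the choice of period.\<close>

lemma continuous_into_countable_constant:
  fixes g :: "'a::topological_space \<Rightarrow> 'b::metric_space"
  assumes "continuous_on S g" "connected S" "g ` S \<subseteq> C" "countable C" "x \<in> S" "y \<in> S"
  shows "g x = g y"
proof (rule ccontr)
  assume "g x \<noteq> g y"
  moreover have "connected (g ` S)" using assms by (intro connected_continuous_image)
  ultimately have "uncountable (g ` S)" using connected_uncountable assms by blast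
  then show False using assms countable_subset by blast
qed

text \<open>Normalise the primitive on a disc by \<open>F a = 0\<close>, so that \<open>F z\<close>
  is the integral along the segment from \<open>a\<close> to \<open>z\<close>. Putting this segment
  in front of \<open>p\<close> makes the sum the integral of a path from the fixed point
  \<open>a\<close> to \<open>b\<close>, and such integrals form a countable set that does not depend
  on \<open>z\<close>.\<close>

lemma contour_integral_local_primitive:
  assumes "open U" "f holomorphic_on U" "a \<in> U"
  obtains r F C where "0 < r" "ball a r \<subseteq> U" "countable C"
    "\<And>z. z \<in> ball a r \<Longrightarrow> (F has_field_derivative f z) (at z)"
    "\<And>z p. z \<in> ball a r \<Longrightarrow> valid_path p \<Longrightarrow> path_image p \<subseteq> U \<Longrightarrow> pathstart p = z \<Longrightarrow>
       pathfinish p = b \<Longrightarrow> F z + contour_integral p f \<in> C"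
proof -
  obtain r where r: "0 < r" "ball a r \<subseteq> U" using assms openE by blast
  have "f holomorphic_on ball a r" using assms(2) r(2) by (rule holomorphic_on_subset)
  then obtain F0 where
      "\<And>z. z \<in> ball a r \<Longrightarrow> (F0 has_field_derivative f z) (at z within ball a r)"
    using holomorphic_convex_primitive'[of "ball a r" f] by auto
  then have F0: "\<And>z. z \<in> ball a r \<Longrightarrow> (F0 has_field_derivative f z) (at z)"
    by (metis at_within_open open_ball)
  define C where "C = {contour_integral p f | p. valid_path p \<and> path_image p \<subseteq> U \<and>
           pathstart p = a \<and> pathfinish p = b}"
  show thesis
  proof (rule that[of r C "\<lambda>z. F0 z - F0 a"])
    show "countable C" unfolding C_def using assms(1,2) by (rule countable_contour_integrals)
    show "((\<lambda>z. F0 z - F0 a) has_field_derivative f z) (at z)" if "z \<in> ball a r" for z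
      using F0[OF that] by (auto intro!: derivative_eq_intros)
    fix z p assume z: "z \<in> ball a r" and p: "valid_path p" "path_image p \<subseteq> U"
        "pathstart p = z" "pathfinish p = b"
    have seg: "closed_segment a z \<subseteq> ball a r"
      using z r(1) by (intro closed_segment_subset) auto
    have "(f has_contour_integral (F0 z - F0 a)) (linepath a z)"
      using contour_integral_primitive[of "ball a r" F0 f "linepath a z"] F0 seg
      by (simp add: has_field_derivative_at_within)
    moreover have "(f has_contour_integral contour_integral p f) p"
      using contour_integrable_holomorphic_simple assms p has_contour_integral_integral by blast
    ultimately have "(f has_contour_integral (F0 z - F0 a + contour_integral p f)) (linepath a z +++ p)"
      using p by (intro has_contour_integral_join) auto
    then have "F0 z - F0 a + contour_integral p f = contour_integral (linepath a z +++ p) f"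
      by (simp add: contour_integral_unique)
    moreover have "path_image (linepath a z +++ p) \<subseteq> U"
      using p seg r by (subst path_image_join) auto
    ultimately show "F0 z - F0 a + contour_integral p f \<in> C"
      unfolding C_def using p by (auto intro!: exI[of _ "linepath a z +++ p"] valid_path_join)
  qed (use r in auto)
qed

lemma open_cnj_image: "open U \<Longrightarrow> open (cnj ` U)"
proof -
  assume "open U"
  moreover have "cnj ` U = cnj -` U" by (auto simp: image_iff) (metis complex_cnj_cnj)
  ultimately show ?thesis by (simp add: continuous_open_vimage isCont_cnj)
qed

lemma continuous_on_separated_sum:
  fixes F G :: "complex \<Rightarrow> complex"
  assumes "continuous_on A F" "continuous_on B G"
  shows "continuous_on (A \<times> B) (\<lambda>w. F (fst w) + G (snd w))"
proof -
  have "continuous_on (A \<times> B) (\<lambda>w. F (fst w))" "continuous_on (A \<times> B) (\<lambda>w. G (snd w))"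
    by (rule continuous_on_compose2[OF assms(1)] continuous_on_compose2[OF assms(2)];
        auto intro: continuous_on_fst continuous_on_snd continuous_on_id)+
  then show ?thesis by (rule continuous_on_add)
qed

text \<open>Take the normalised primitives of both integrands near \<open>a\<close> and
  \<open>b\<close>. The difference between \<open>v\<close> and their sum is continuous on a product
  of two balls, which is connected, and takes only countably many values. Hence it is
  constant.\<close>

lemma integral_branch_locally_separated:
  assumes U: "open U" "0 \<notin> U" and u1: "u1 holomorphic_on U" and u2: "u2 holomorphic_on cnj ` U"
    and W: "open W" and v: "integral_branch U u1 u2 z0 W v" and ab: "(a, b) \<in> W"
  obtains r s F G where "0 < r" "0 < s" "ball a r \<times> ball b s \<subseteq> W"
    "\<And>z. z \<in> ball a r \<Longrightarrow> (F has_field_derivative u1 z / z) (at z)"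
    "\<And>\<zeta>. \<zeta> \<in> ball b s \<Longrightarrow> (G has_field_derivative u2 \<zeta> / \<zeta>) (at \<zeta>)"
    "\<And>z \<zeta>. z \<in> ball a r \<Longrightarrow> \<zeta> \<in> ball b s \<Longrightarrow> v (z, \<zeta>) = F z + G \<zeta>"
proof -
  let ?f = "\<lambda>\<tau>. u1 \<tau> / \<tau>" and ?g = "\<lambda>\<xi>. u2 \<xi> / \<xi>"
  have paths: "\<exists>p q. valid_path p \<and> path_image p \<subseteq> U \<and> pathstart p = z \<and> pathfinish p = z0 \<and>
        valid_path q \<and> path_image q \<subseteq> cnj ` U \<and> pathstart q = \<zeta> \<and> pathfinish q = cnj z0 \<and>
        v (z, \<zeta>) = v (z0, cnj z0) - contour_integral p ?f - contour_integral q ?g"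
    if "(z, \<zeta>) \<in> W" for z \<zeta>
    using v that unfolding integral_branch_def by fast
  \<comment> \<open>The paths demanded by the branch start at \<open>a\<close> and \<open>b\<close>,
    so these points lie in the domains of the integrands.\<close>
  have a: "a \<in> U" and b: "b \<in> cnj ` U"
    using paths[OF ab] by (metis pathstart_in_path_image subsetD)+
  have fg: "?f holomorphic_on U" "?g holomorphic_on cnj ` U"
    using U u1 u2 by (auto intro!: holomorphic_intros)
  obtain r1 F C where rs1: "0 < r1" and CD: "countable C"
    and F: "\<And>z. z \<in> ball a r1 \<Longrightarrow> (F has_field_derivative ?f z) (at z)"
    and C: "\<And>z p. z \<in> ball a r1 \<Longrightarrow> valid_path p \<Longrightarrow> path_image p \<subseteq> U \<Longrightarrow> pathstart p = z \<Longrightarrow>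
       pathfinish p = z0 \<Longrightarrow> F z + contour_integral p ?f \<in> C"
    by (rule contour_integral_local_primitive[OF U(1) fg(1) a]) blast
  obtain s1 G D where rs1': "0 < s1" and CD': "countable D"
    and G: "\<And>z. z \<in> ball b s1 \<Longrightarrow> (G has_field_derivative ?g z) (at z)"
    and D: "\<And>z p. z \<in> ball b s1 \<Longrightarrow> valid_path p \<Longrightarrow> path_image p \<subseteq> cnj ` U \<Longrightarrow> pathstart p = z \<Longrightarrow>
       pathfinish p = cnj z0 \<Longrightarrow> G z + contour_integral p ?g \<in> D"
    by (rule contour_integral_local_primitive[OF open_cnj_image[OF U(1)] fg(2) b]) blast
  note rs1 = rs1 rs1' and CD = CD CD'
  obtain A B where AB: "open A" "open B" "a \<in> A" "b \<in> B" "A \<times> B \<subseteq> W"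
    using W ab by (metis SigmaE2 open_prod_elim)
  obtain r2 s2 where rs2: "0 < r2" "ball a r2 \<subseteq> A" "0 < s2" "ball b s2 \<subseteq> B"
    using AB by (metis openE)
  define r where "r = min r1 r2"
  define s where "s = min s1 s2"
  have sub: "ball a r \<subseteq> ball a r1" "ball b s \<subseteq> ball b s1" "ball a r \<times> ball b s \<subseteq> W"
    using rs2 AB by (auto simp: r_def s_def subset_iff)
  define h where "h = (\<lambda>w. v w - (F (fst w) + G (snd w)))"
  \<comment> \<open>In \<open>h (z, \<zeta>)\<close> each integral is grouped with the primitive at
    its starting point. The two groups lie in \<open>C\<close> and \<open>D\<close>, and the rest is
    the value of \<open>v\<close> at the base point.\<close>
  define E where "E = (\<lambda>(x, y). v (z0, cnj z0) - x - y) ` (C \<times> D)"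
  have "continuous_on (ball a r) F" "continuous_on (ball b s) G"
    using F G sub by (meson DERIV_isCont continuous_at_imp_continuous_on subsetD)+
  then have "continuous_on (ball a r \<times> ball b s) (\<lambda>w. F (fst w) + G (snd w))"
    by (rule continuous_on_separated_sum)
  moreover have "continuous_on (ball a r \<times> ball b s) v"
    using conjunct1[OF v[unfolded integral_branch_def]] sub(3) by (rule continuous_on_subset)
  ultimately have "continuous_on (ball a r \<times> ball b s) h"
    unfolding h_def by (intro continuous_on_diff)
  moreover have "connected (ball a r \<times> ball b s)" by (simp add: connected_Times)
  moreover have "h ` (ball a r \<times> ball b s) \<subseteq> E"
  proof clarify
    fix z \<zeta> assume zz: "z \<in> ball a r" "\<zeta> \<in> ball b s"
    then have "(z, \<zeta>) \<in> W" using sub by auto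
    from paths[OF this] obtain p q where pq: "valid_path p" "path_image p \<subseteq> U" "pathstart p = z"
        "pathfinish p = z0" "valid_path q" "path_image q \<subseteq> cnj ` U" "pathstart q = \<zeta>"
        "pathfinish q = cnj z0"
        "v (z, \<zeta>) = v (z0, cnj z0) - contour_integral p ?f - contour_integral q ?g"
      by blast
    have "F z + contour_integral p ?f \<in> C" "G \<zeta> + contour_integral q ?g \<in> D"
      using C D zz pq sub by blast+
    then show "h (z, \<zeta>) \<in> E" unfolding h_def E_def using pq(9)
      by (auto intro!: image_eqI[of _ _ "(F z + contour_integral p ?f, G \<zeta> + contour_integral q ?g)"])
  qed
  moreover have "countable E" unfolding E_def using CD by auto
  moreover have "a \<in> ball a r" "b \<in> ball b s" using rs1 rs2 by (auto simp: r_def s_def)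
  ultimately have const: "h (z, \<zeta>) = h (a, b)" if "z \<in> ball a r" "\<zeta> \<in> ball b s" for z \<zeta>
    using continuous_into_countable_constant[of "ball a r \<times> ball b s" h E "(z, \<zeta>)" "(a, b)"] that
    by blast
  show thesis
  \<comment> \<open>The constant difference is absorbed into the first summand.\<close>
  proof (rule that[of r s "\<lambda>z. F z + h (a, b)" G])
    show "((\<lambda>z. F z + h (a, b)) has_field_derivative u1 z / z) (at z)" if "z \<in> ball a r" for z
      using F[of z] that sub by (auto intro!: derivative_eq_intros)
    show "v (z, \<zeta>) = F z + h (a, b) + G \<zeta>" if "z \<in> ball a r" "\<zeta> \<in> ball b s" for z \<zeta>
      using const[OF that] by (simp add: h_def algebra_simps)
  qed (use G sub rs1 rs2 in \<open>auto simp: r_def s_def\<close>)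
qed

section \<open>Functions of the form \<open>F z + G \<zeta>\<close> and the Neumann
  condition\<close>

lemma separated_has_derivative:
  assumes "open A" "open B" "a \<in> A" "b \<in> B"
    and "(F has_field_derivative f) (at a)" "(G has_field_derivative g) (at b)"
    and "\<And>z \<zeta>. z \<in> A \<Longrightarrow> \<zeta> \<in> B \<Longrightarrow> v (z, \<zeta>) = F z + G \<zeta>"
  shows "(v has_derivative (\<lambda>(h, k). f * h + g * k)) (at (a, b))"
proof (rule has_derivative_transform_within_open)
  show "((\<lambda>w. F (fst w) + G (snd w)) has_derivative (\<lambda>(h, k). f * h + g * k)) (at (a, b))"
  proof -
    have "((\<lambda>w. F (fst w)) has_derivative (\<lambda>w. f * fst w)) (at (a, b))"
      using has_derivative_compose[of fst fst "(a, b)" UNIV F "\<lambda>h. f * h"] assms(5)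
      by (simp add: has_field_derivative_def has_derivative_fst)
    moreover have "((\<lambda>w. G (snd w)) has_derivative (\<lambda>w. g * snd w)) (at (a, b))"
      using has_derivative_compose[of snd snd "(a, b)" UNIV G "\<lambda>h. g * h"] assms(6)
      by (simp add: has_field_derivative_def has_derivative_snd)
    ultimately show ?thesis
      using has_derivative_add by (fastforce simp: case_prod_unfold)
  qed
  show "open (A \<times> B)" using assms by (simp add: open_Times)
qed (use assms in auto)

text \<open>The inner derivative in \<zeta> at \<open>b\<close> equals \<open>g\<close> for every
  \<open>z\<close> in \<open>A\<close>, so the outer derivative is that of a function constant near
  \<open>a\<close>.\<close>

lemma separated_laplacian2:
  assumes "open A" "open B" "a \<in> A" "b \<in> B"
    and "(G has_field_derivative g) (at b)"
    and "\<And>z \<zeta>. z \<in> A \<Longrightarrow> \<zeta> \<in> B \<Longrightarrow> v (z, \<zeta>) = F z + G \<zeta>"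
  shows "laplacian2 v (a, b) = 0"
proof -
  have "deriv (\<lambda>\<zeta>. v (z, \<zeta>)) b = g" if "z \<in> A" for z
  proof (rule DERIV_imp_deriv, rule has_field_derivative_transform_within_open)
    show "((\<lambda>\<zeta>. F z + G \<zeta>) has_field_derivative g) (at b)"
      using assms(5) by (auto intro!: derivative_eq_intros)
  qed (use assms that in auto)
  then have "eventually (\<lambda>z. deriv (\<lambda>\<zeta>. v (z, \<zeta>)) b = g) (nhds a)"
    using assms(1,3) eventually_nhds by blast
  then show ?thesis
    unfolding laplacian2_def by (simp add: deriv_cong_ev)
qed

lemma integral_branch_neumann_solution:
  assumes U: "open U" "0 \<notin> U" and u1: "u1 holomorphic_on U" and u2: "u2 holomorphic_on cnj ` U"
    and W: "open W" "real_points \<Gamma> \<subseteq> W" and v: "integral_branch U u1 u2 z0 W v"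
    and \<Gamma>: "\<Gamma> \<subseteq> U" "\<And>z. z \<in> \<Gamma> \<Longrightarrow> u1 z + u2 (cnj z) = \<phi> z"
  shows "neumann_solution \<Gamma> \<phi> v"
  unfolding neumann_solution_def harmonic_near_def
proof (intro conjI ballI exI[of _ W] W)
  show "holomorphic2_on v W"
    unfolding holomorphic2_on_def
  proof (clarify)
    fix a b assume ab: "(a, b) \<in> W"
    obtain r s F G where "0 < r" "0 < s" "ball a r \<times> ball b s \<subseteq> W"
      "\<And>z. z \<in> ball a r \<Longrightarrow> (F has_field_derivative u1 z / z) (at z)"
      "\<And>\<zeta>. \<zeta> \<in> ball b s \<Longrightarrow> (G has_field_derivative u2 \<zeta> / \<zeta>) (at \<zeta>)"
      "\<And>z \<zeta>. z \<in> ball a r \<Longrightarrow> \<zeta> \<in> ball b s \<Longrightarrow> v (z, \<zeta>) = F z + G \<zeta>"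
      using integral_branch_locally_separated[OF U u1 u2 W(1) v ab] by blast
    then show "\<exists>c d. (v has_derivative (\<lambda>(h, k). c * h + d * k)) (at (a, b) within W)"
      using separated_has_derivative[of "ball a r" "ball b s" a b F "u1 a / a" G "u2 b / b" v]
      by (meson centre_in_ball has_derivative_at_withinI open_ball)
  qed
next
  fix w assume "w \<in> W"
  then obtain a b where w: "w = (a, b)" and ab: "(a, b) \<in> W" by (cases w) auto
  obtain r s F G where "0 < r" "0 < s" "ball a r \<times> ball b s \<subseteq> W"
    "\<And>z. z \<in> ball a r \<Longrightarrow> (F has_field_derivative u1 z / z) (at z)"
    "\<And>\<zeta>. \<zeta> \<in> ball b s \<Longrightarrow> (G has_field_derivative u2 \<zeta> / \<zeta>) (at \<zeta>)"
    "\<And>z \<zeta>. z \<in> ball a r \<Longrightarrow> \<zeta> \<in> ball b s \<Longrightarrow> v (z, \<zeta>) = F z + G \<zeta>"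
    using integral_branch_locally_separated[OF U u1 u2 W(1) v ab] by blast
  then show "laplacian2 v w = 0"
    using separated_laplacian2[of "ball a r" "ball b s" a b G "u2 b / b" v F] w by simp
next
  fix z assume z: "z \<in> \<Gamma>"
  then have z0: "z \<noteq> 0" and zW: "(z, cnj z) \<in> W" using \<Gamma> U W by (auto simp: real_points_def)
  obtain r s F G where rs: "0 < r" "0 < s" "ball z r \<times> ball (cnj z) s \<subseteq> W"
    and F: "\<And>z'. z' \<in> ball z r \<Longrightarrow> (F has_field_derivative u1 z' / z') (at z')"
    and G: "\<And>\<zeta>. \<zeta> \<in> ball (cnj z) s \<Longrightarrow> (G has_field_derivative u2 \<zeta> / \<zeta>) (at \<zeta>)"
    and FG: "\<And>z' \<zeta>. z' \<in> ball z r \<Longrightarrow> \<zeta> \<in> ball (cnj z) s \<Longrightarrow> v (z', \<zeta>) = F z' + G \<zeta>"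
    using integral_branch_locally_separated[OF U u1 u2 W(1) v zW] by blast
  \<comment> \<open>The curve is the radial line through \<open>z\<close>, and its conjugate has
    velocity \<open>cnj z\<close>. In the chain rule these velocities cancel the denominators of
    \<open>u1 z / z\<close> and \<open>u2 (cnj z) / cnj z\<close>, which leaves the Dirichlet
    data.\<close>
  let ?\<gamma> = "\<lambda>t::real. z + of_real t * z"
  have \<gamma>: "(?\<gamma> has_vector_derivative z) (at 0)"
    by (auto intro!: derivative_eq_intros simp: has_vector_derivative_def scaleR_conv_of_real)
  have \<gamma>': "((\<lambda>t. cnj (?\<gamma> t)) has_vector_derivative cnj z) (at 0)"
    using \<gamma> by (rule has_vector_derivative_cnj)
  have "((F \<circ> ?\<gamma>) has_vector_derivative z * (u1 z / z)) (at 0)"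
    using \<gamma> F[of z] rs by (intro field_vector_diff_chain_at) auto
  moreover have "((G \<circ> (\<lambda>t. cnj (?\<gamma> t))) has_vector_derivative cnj z * (u2 (cnj z) / cnj z)) (at 0)"
    using \<gamma>' G[of "cnj z"] rs by (intro field_vector_diff_chain_at) auto
  ultimately have "((\<lambda>t. F (?\<gamma> t) + G (cnj (?\<gamma> t))) has_vector_derivative
      z * (u1 z / z) + cnj z * (u2 (cnj z) / cnj z)) (at 0)"
    unfolding o_def by (rule has_vector_derivative_add)
  then have "((\<lambda>t. F (?\<gamma> t) + G (cnj (?\<gamma> t))) has_vector_derivative \<phi> z) (at 0)"
    using z0 \<Gamma>(2)[OF z] by simp
  moreover have "eventually (\<lambda>t. F (?\<gamma> t) + G (cnj (?\<gamma> t)) = v (?\<gamma> t, cnj (?\<gamma> t))) (nhds 0)"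
  proof -
    have "open (?\<gamma> -` ball z r \<inter> (\<lambda>t. cnj (?\<gamma> t)) -` ball (cnj z) s)"
      by (intro open_Int open_vimage open_ball continuous_intros)
    moreover have "0 \<in> ?\<gamma> -` ball z r \<inter> (\<lambda>t. cnj (?\<gamma> t)) -` ball (cnj z) s"
      using rs by simp
    ultimately show ?thesis using FG eventually_nhds by (smt (verit) IntE vimageE)
  qed
  moreover from this have "F (?\<gamma> 0) + G (cnj (?\<gamma> 0)) = v (?\<gamma> 0, cnj (?\<gamma> 0))"
    by (rule eventually_nhds_x_imp_x)
  ultimately show "has_directional_derivative v z (\<phi> z) z"
    unfolding has_directional_derivative_def
    by (subst (asm) has_vector_derivative_cong_ev) auto
qed

section \<open>A simply connected neighbourhood of a proper connected part of the circle\<close>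

text \<open>A compact segment in \<open>V\<close> has a uniform margin \<open>e\<close>. If both
  endpoints move by less than \<open>e\<close>, then so does every point with the same convex
  parameter.\<close>

lemma open_segments_within:
  fixes P Q :: "'a::metric_space \<Rightarrow> 'b::real_normed_vector"
  assumes "open V" and P: "continuous_on UNIV P" and Q: "continuous_on UNIV Q"
  shows "open {w. closed_segment (P w) (Q w) \<subseteq> V}"
proof (subst open_subopen, clarify)
  fix w assume "closed_segment (P w) (Q w) \<subseteq> V"
  then obtain e where e: "0 < e" "(\<Union>x\<in>closed_segment (P w) (Q w). ball x e) \<subseteq> V"
    using compact_subset_open_imp_ball_epsilon_subset[OF compact_segment \<open>open V\<close>] by blast
  let ?T = "P -` ball (P w) e \<inter> Q -` ball (Q w) e"
  have "open ?T" using P Q by (intro open_Int open_vimage) auto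
  moreover have "w \<in> ?T" using e by simp
  moreover have "closed_segment (P w') (Q w') \<subseteq> V" if w': "w' \<in> ?T" for w'
  proof
    fix x assume "x \<in> closed_segment (P w') (Q w')"
    then obtain t where t: "0 \<le> t" "t \<le> 1" "x = (1 - t) *\<^sub>R P w' + t *\<^sub>R Q w'"
      by (auto simp: in_segment)
    define y where "y = (1 - t) *\<^sub>R P w + t *\<^sub>R Q w"
    have "y - x = (1 - t) *\<^sub>R (P w - P w') + t *\<^sub>R (Q w - Q w')"
      by (simp add: y_def t algebra_simps)
    also have "norm \<dots> \<le> (1 - t) * norm (P w - P w') + t * norm (Q w - Q w')"
      using t norm_triangle_ineq[of "(1 - t) *\<^sub>R (P w - P w')" "t *\<^sub>R (Q w - Q w')"] by simp
    also have "\<dots> < e"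
      using w' t by (intro convex_bound_lt) (auto simp: dist_norm)
    finally have "x \<in> ball y e" by (simp add: dist_norm)
    moreover have "y \<in> closed_segment (P w) (Q w)" using t by (auto simp: y_def in_segment)
    ultimately show "x \<in> V" using e by blast
  qed
  ultimately show "\<exists>T. open T \<and> w \<in> T \<and> T \<subseteq> {w. closed_segment (P w) (Q w) \<subseteq> V}"
    by blast
qed

text \<open>Near the imaginary axis, keep the points that can be moved inside \<open>V\<close> first horizontally to
  the axis and then along the axis to the base point.\<close>

lemma contractible_neighborhood_in_imaginary_axis:
  assumes V: "open V" and y0: "y0 \<in> K" and K: "connected (K :: real set)"
    and KV: "\<And>y. y \<in> K \<Longrightarrow> \<i> * of_real y \<in> V"
  obtains M where "open M" "contractible M" "M \<subseteq> V" "\<And>y. y \<in> K \<Longrightarrow> \<i> * of_real y \<in> M"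
proof -
  define P where "P = (\<lambda>w. \<i> * of_real (Im w))"
  define b where "b = \<i> * of_real y0"
  define M where "M = {w. closed_segment w (P w) \<subseteq> V} \<inter> {w. closed_segment (P w) b \<subseteq> V}"
  have contP: "continuous_on A P" for A unfolding P_def by (intro continuous_intros)
  have PP: "P (P w) = P w" for w by (simp add: P_def)
  have Pseg: "P x = P w" if "x \<in> closed_segment w (P w)" for x w
  proof -
    from that obtain u where "x = (1 - u) *\<^sub>R w + u *\<^sub>R P w" by (auto simp: in_segment)
    then have "Im x = (1 - u) * Im w + u * Im (P w)" by simp
    then show ?thesis by (simp add: P_def algebra_simps)
  qed
  have Pseg2: "P x = x" if "x \<in> closed_segment (P w) b" for x w
    using that by (auto simp: P_def b_def in_segment complex_eq_iff)
  have "open M"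
    unfolding M_def using V contP by (intro open_Int open_segments_within) (auto intro: continuous_intros)
  moreover have "contractible M"
  proof -
    \<comment> \<open>The contraction has two linear stages, and each stays in \<open>M\<close>. A
      point of the horizontal segment has the same projection as \<open>w\<close> and a shorter way
      to it. A point of the segment on the axis is its own projection and has a shorter way to
      \<open>b\<close>.\<close>
    have "homotopic_with_canon (\<lambda>x. True) M M id P"
    proof (rule homotopic_with_linear)
      fix w assume w: "w \<in> M"
      show "closed_segment (id w) (P w) \<subseteq> M"
      proof
        fix x assume "x \<in> closed_segment (id w) (P w)"
        then have x: "x \<in> closed_segment w (P w)" by simp
        then have "closed_segment x (P w) \<subseteq> closed_segment w (P w)"
          by (simp add: subset_closed_segment)
        then show "x \<in> M" using w Pseg[OF x] by (auto simp: M_def)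
      qed
    qed (use contP in \<open>auto intro: continuous_intros\<close>)
    moreover have "homotopic_with_canon (\<lambda>x. True) M M P (\<lambda>x. b)"
    proof (rule homotopic_with_linear)
      fix w assume w: "w \<in> M"
      show "closed_segment (P w) b \<subseteq> M"
      proof
        fix x assume x: "x \<in> closed_segment (P w) b"
        then have "closed_segment x b \<subseteq> closed_segment (P w) b"
          by (simp add: subset_closed_segment)
        then show "x \<in> M" using w Pseg2[OF x] x by (auto simp: M_def)
      qed
    qed (use contP in \<open>auto intro: continuous_intros\<close>)
    ultimately show ?thesis unfolding contractible_def by (blast intro: homotopic_with_trans)
  qed
  moreover have "M \<subseteq> V" by (auto simp: M_def)
  moreover have "\<i> * of_real y \<in> M" if y: "y \<in> K" for y
  proof -
    \<comment> \<open>A connected set of reals is convex, so this segment consists of points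
      \<open>\<i> * of_real y'\<close> with \<open>y'\<close> in \<open>K\<close>.\<close>
    have "closed_segment (\<i> * of_real y) b \<subseteq> V"
    proof
      fix x assume "x \<in> closed_segment (\<i> * of_real y) b"
      then obtain t where t: "0 \<le> t" "t \<le> 1" "x = (1 - t) *\<^sub>R (\<i> * of_real y) + t *\<^sub>R b"
        by (auto simp: in_segment)
      then have "x = \<i> * of_real ((1 - t) *\<^sub>R y + t *\<^sub>R y0)"
        by (simp add: b_def complex_eq_iff)
      moreover have "(1 - t) *\<^sub>R y + t *\<^sub>R y0 \<in> K"
        using K y y0 t unfolding is_interval_connected_1[symmetric] is_interval_convex_1 convex_alt
        by blast
      ultimately show "x \<in> V" using KV by metis
    qed
    then show ?thesis using KV[OF y] by (simp add: M_def P_def)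
  qed
  ultimately show thesis by (rule that)
qed

text \<open>Cut the circle at an omitted point and unroll it by a logarithm. The set then lies on
  the imaginary axis, where a contractible neighbourhood is available, and the exponential carries
  that neighbourhood back homeomorphically.\<close>

lemma proper_circle_subset_neighborhood:
  fixes \<Gamma> U :: "complex set"
  assumes conn: "connected \<Gamma>" and sph: "\<Gamma> \<subset> sphere 0 1" and U: "open U" "\<Gamma> \<subseteq> U"
  obtains S where "open S" "simply_connected S" "\<Gamma> \<subseteq> S" "S \<subseteq> U"
proof (cases "\<Gamma> = {}")
  case True
  then show ?thesis using that[of "{}"] by (simp add: convex_imp_simply_connected)
next
  case False
  then obtain z1 where z1: "z1 \<in> \<Gamma>" by blast
  obtain \<omega> where \<omega>: "cmod \<omega> = 1" "\<omega> \<notin> \<Gamma>" using sph by (auto simp: psubset_eq set_eq_iff)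
  then have \<omega>0: "\<omega> \<noteq> 0" by auto
  \<comment> \<open>The factor \<open>- \<omega>\<close> places the omitted point on the branch cut:
    for \<open>z = \<omega>\<close> the argument of \<open>Ln\<close> is -1. On the circle the cut
    meets no other point.\<close>
  define g where "g = (\<lambda>w. - \<omega> * exp w)"
  define L where "L = (\<lambda>z. Ln (- z / \<omega>))"
  define V where "V = {w. Im w < pi} \<inter> {w. - pi < Im w} \<inter> g -` U"
  have contg: "continuous_on A g" for A unfolding g_def by (intro continuous_intros)
  have one: "cmod z = 1" if "z \<in> \<Gamma>" for z
    using that sph by (auto dest!: psubset_imp_subset)
  have gL: "g (L z) = z" if "z \<in> \<Gamma>" for z
  proof -
    have "z \<noteq> 0" using one[OF that] by auto
    then show ?thesis using \<omega>0 by (simp add: g_def L_def)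
  qed
  have unit: "cmod (- z / \<omega>) = 1" if "z \<in> \<Gamma>" for z
    using one[OF that] \<omega> by (simp add: norm_divide)
  have slit: "- z / \<omega> \<notin> \<real>\<^sub>\<le>\<^sub>0" if z: "z \<in> \<Gamma>" for z
  proof
    assume "- z / \<omega> \<in> \<real>\<^sub>\<le>\<^sub>0"
    then obtain r where r: "- z / \<omega> = of_real r" "r \<le> 0" by (rule nonpos_Reals_cases)
    have "\<bar>r\<bar> = 1" using unit[OF z] unfolding r(1) by simp
    with r(2) have "r = -1" by simp
    then have "z = \<omega>" using r \<omega>0 by (simp add: field_simps)
    then show False using z \<omega> by simp
  qed
  have L: "L z = \<i> * of_real (Im (L z))" if z: "z \<in> \<Gamma>" for z
  proof -
    have "- z / \<omega> \<noteq> 0" using unit[OF z] by auto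
    then have "Re (L z) = 0" unfolding L_def using Re_Ln[of "- z / \<omega>"] unit[OF z] by simp
    then show ?thesis by (simp add: complex_eq_iff)
  qed
  have LV: "L z \<in> V" if z: "z \<in> \<Gamma>" for z
  proof -
    have nz: "- z / \<omega> \<noteq> 0" using unit[OF z] by auto
    have "Im (L z) \<noteq> pi"
      using slit[OF z] Im_Ln_eq_pi[OF nz] unfolding L_def
      by (auto simp: complex_nonpos_Reals_iff)
    then show ?thesis
      using z U gL mpi_less_Im_Ln[OF nz] Im_Ln_le_pi[OF nz] by (auto simp: V_def L_def)
  qed
  have "continuous_on \<Gamma> L"
    unfolding L_def using slit \<omega>0 by (intro continuous_intros) auto
  then have "connected ((\<lambda>z. Im (L z)) ` \<Gamma>)"
    using conn by (intro connected_continuous_image continuous_intros)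
  moreover have "open V"
    unfolding V_def using U contg[of UNIV]
    by (intro open_Int open_vimage open_halfspace_Im_lt open_halfspace_Im_gt) auto
  moreover have "\<i> * of_real y \<in> V" if "y \<in> (\<lambda>z. Im (L z)) ` \<Gamma>" for y
    using that L LV by force
  ultimately obtain M where M: "open M" "contractible M" "M \<subseteq> V"
      "\<And>y. y \<in> (\<lambda>z. Im (L z)) ` \<Gamma> \<Longrightarrow> \<i> * of_real y \<in> M"
    using contractible_neighborhood_in_imaginary_axis[of V "Im (L z1)" "(\<lambda>z. Im (L z)) ` \<Gamma>"] z1
    by blast
  \<comment> \<open>\<open>M\<close> lies in a strip of height \<open>2 * pi\<close>, where the
    exponential is injective. Invariance of domain then makes \<open>g\<close> a homeomorphism from
    \<open>M\<close> onto an open set.\<close>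
  have inj: "inj_on g M"
  proof (rule inj_onI)
    fix x y assume xy: "x \<in> M" "y \<in> M" "g x = g y"
    then have "x \<in> V" "y \<in> V" using M by auto
    then have "\<bar>Im x - Im y\<bar> < 2 * pi" by (auto simp: V_def)
    then show "x = y" using xy(3) \<omega>0 exp_complex_eqI by (simp add: g_def)
  qed
  show ?thesis
  proof (rule that[of "g ` M"])
    show "open (g ` M)" using contg M(1) inj by (rule invariance_of_domain)
    have "M homeomorphic g ` M"
      using M(1) contg inj by (intro invariance_of_domain_homeomorphic) auto
    then show "simply_connected (g ` M)"
      using M(2) contractible_imp_simply_connected homeomorphic_simply_connected by blast
    show "\<Gamma> \<subseteq> g ` M" using gL L M(4) by (metis image_eqI subsetI)
    show "g ` M \<subseteq> U" using M(3) by (auto simp: V_def)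
  qed
qed

section \<open>Existence of a continuous branch with a prescribed value at the base point\<close>

text \<open>The base point \<open>z0\<close> may lie outside \<open>S\<close>. One fixed path
  \<open>a\<close> in \<open>U\<close> joins some \<open>z1\<close> in \<open>S\<close> to
  \<open>z0\<close>, and every \<open>z\<close> in \<open>S\<close> first goes to \<open>z1\<close>
  inside \<open>S\<close>, where a global primitive \<open>H\<close> computes the integral.\<close>

lemma simply_connected_primitive_from_base_point:
  assumes U: "open U" "connected U" "z0 \<in> U" and f: "f holomorphic_on U"
    and S: "open S" "simply_connected S" "S \<subseteq> U"
  obtains F where "continuous_on S F" "z0 \<in> S \<Longrightarrow> F z0 = 0"
    "\<And>z. z \<in> S \<Longrightarrow> \<exists>p. valid_path p \<and> path_image p \<subseteq> U \<and> pathstart p = z \<and>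
        pathfinish p = z0 \<and> contour_integral p f = - F z"
proof (cases "S = {}")
  case True
  then show ?thesis using that[of "\<lambda>_. 0"] by simp
next
  case False
  obtain H where H: "\<And>z. z \<in> S \<Longrightarrow> (H has_field_derivative f z) (at z)"
    using simply_connected_eq_global_primitive[OF S(1)] S f holomorphic_on_subset by meson
  have path_in: "\<exists>p. valid_path p \<and> path_image p \<subseteq> A \<and> pathstart p = x \<and> pathfinish p = y"
    if "open A" "connected A" "x \<in> A" "y \<in> A" for A and x y :: complex
    using connected_open_polynomial_connected[OF that] valid_path_polynomial_function by blast
  \<comment> \<open>If \<open>z0\<close> is in \<open>S\<close>, the connecting path is constant
    with integral 0, which forces the resulting function to vanish at \<open>z0\<close>.\<close>
  have "\<exists>z1 a. z1 \<in> S \<and> valid_path a \<and> path_image a \<subseteq> U \<and> pathstart a = z1 \<and> pathfinish a = z0 \<and>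
      (z0 \<in> S \<longrightarrow> z1 = z0 \<and> contour_integral a f = 0)"
  proof (cases "z0 \<in> S")
    case True
    then show ?thesis using U by (intro exI[of _ z0] exI[of _ "linepath z0 z0"]) auto
  next
    case z0: False
    obtain z1 where "z1 \<in> S" using False by blast
    then show ?thesis using path_in[of U z1 z0] U S z0 by blast
  qed
  then obtain z1 a where z1: "z1 \<in> S" and a: "valid_path a" "path_image a \<subseteq> U"
      "pathstart a = z1" "pathfinish a = z0" "z0 \<in> S \<Longrightarrow> z1 = z0 \<and> contour_integral a f = 0"
    by blast
  show ?thesis
  proof (rule that[of "\<lambda>z. H z - H z1 - contour_integral a f"])
    show "continuous_on S (\<lambda>z. H z - H z1 - contour_integral a f)"
      using H by (intro continuous_intros) (meson DERIV_isCont continuous_at_imp_continuous_on)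
    show "H z0 - H z1 - contour_integral a f = 0" if "z0 \<in> S" using a(5)[OF that] by simp
    fix z assume z: "z \<in> S"
    obtain p where p: "valid_path p" "path_image p \<subseteq> S" "pathstart p = z" "pathfinish p = z1"
      using path_in[OF S(1) simply_connected_imp_connected[OF S(2)] z z1] by blast
    have "(f has_contour_integral (H z1 - H z)) p"
      using contour_integral_primitive[of S H f p] H p by (simp add: has_field_derivative_at_within)
    moreover have "(f has_contour_integral contour_integral a f) a"
      using contour_integrable_holomorphic_simple U f a has_contour_integral_integral by blast
    ultimately have "(f has_contour_integral (H z1 - H z + contour_integral a f)) (p +++ a)"
      using p a by (intro has_contour_integral_join)
    then have "contour_integral (p +++ a) f = - (H z - H z1 - contour_integral a f)"
      by (simp add: contour_integral_unique)
    moreover have "path_image (p +++ a) \<subseteq> U" using p a S by (subst path_image_join) auto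
    ultimately show "\<exists>p. valid_path p \<and> path_image p \<subseteq> U \<and> pathstart p = z \<and>
        pathfinish p = z0 \<and> contour_integral p f = - (H z - H z1 - contour_integral a f)"
      using p a by (intro exI[of _ "p +++ a"]) (auto intro: valid_path_join)
  qed
qed

lemma integral_branch_exists:
  assumes U: "open U" "connected U" "0 \<notin> U" "z0 \<in> U"
    and u1: "u1 holomorphic_on U" and u2: "u2 holomorphic_on cnj ` U"
    and S: "open S" "simply_connected S" "S \<subseteq> U"
  shows "\<exists>v. integral_branch U u1 u2 z0 (S \<times> cnj ` S) v \<and> v (z0, cnj z0) = c"
proof -
  let ?f = "\<lambda>\<tau>. u1 \<tau> / \<tau>" and ?g = "\<lambda>\<xi>. u2 \<xi> / \<xi>"
  have f: "?f holomorphic_on U" and g: "?g holomorphic_on cnj ` U"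
    using U u1 u2 by (auto intro!: holomorphic_intros)
  have cU: "connected (cnj ` U)"
    using U by (intro connected_continuous_image continuous_intros)
  have "homeomorphism S (cnj ` S) cnj cnj"
    by (auto simp: homeomorphism_def image_image intro!: continuous_intros)
  then have cS: "simply_connected (cnj ` S)"
    using S homeomorphic_simply_connected homeomorphic_def by blast
  have zU: "cnj z0 \<in> cnj ` U" and sub: "cnj ` S \<subseteq> cnj ` U" using U S by auto
  obtain F where F: "continuous_on S F" "z0 \<in> S \<Longrightarrow> F z0 = 0"
    "\<And>z. z \<in> S \<Longrightarrow> \<exists>p. valid_path p \<and> path_image p \<subseteq> U \<and> pathstart p = z \<and>
        pathfinish p = z0 \<and> contour_integral p ?f = - F z"
    by (rule simply_connected_primitive_from_base_point[OF U(1,2,4) f S]) blast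
  obtain G where G: "continuous_on (cnj ` S) G" "cnj z0 \<in> cnj ` S \<Longrightarrow> G (cnj z0) = 0"
    "\<And>z. z \<in> cnj ` S \<Longrightarrow> \<exists>p. valid_path p \<and> path_image p \<subseteq> cnj ` U \<and> pathstart p = z \<and>
        pathfinish p = cnj z0 \<and> contour_integral p ?g = - G z"
    by (rule simply_connected_primitive_from_base_point
          [OF open_cnj_image[OF U(1)] cU zU g open_cnj_image[OF S(1)] cS sub]) blast
  define v where "v = (\<lambda>w. if w = (z0, cnj z0) then c else c + (F (fst w) + G (snd w)))"
  have v: "v w = c + (F (fst w) + G (snd w))" if "w \<in> S \<times> cnj ` S" for w
    using that F(2) G(2) by (auto simp: v_def)
  have "continuous_on (S \<times> cnj ` S) (\<lambda>w. c + (F (fst w) + G (snd w)))"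
    using F(1) G(1) by (intro continuous_on_add continuous_on_const continuous_on_separated_sum)
  then have "continuous_on (S \<times> cnj ` S) v"
    by (rule continuous_on_eq) (use v in auto)
  moreover have "v (z0, cnj z0) = c" by (simp add: v_def)
  moreover have "\<exists>p q. valid_path p \<and> path_image p \<subseteq> U \<and> pathstart p = z \<and> pathfinish p = z0 \<and>
        valid_path q \<and> path_image q \<subseteq> cnj ` U \<and> pathstart q = \<zeta> \<and> pathfinish q = cnj z0 \<and>
        v (z, \<zeta>) = v (z0, cnj z0) - contour_integral p ?f - contour_integral q ?g"
    if "(z, \<zeta>) \<in> S \<times> cnj ` S" for z \<zeta>
  proof -
    have z: "z \<in> S" "\<zeta> \<in> cnj ` S" using that by auto
    obtain p where "valid_path p" "path_image p \<subseteq> U" "pathstart p = z"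
        "pathfinish p = z0" "contour_integral p ?f = - F z" using F(3)[OF z(1)] by blast
    moreover obtain q where "valid_path q" "path_image q \<subseteq> cnj ` U" "pathstart q = \<zeta>"
        "pathfinish q = cnj z0" "contour_integral q ?g = - G \<zeta>" using G(3)[OF z(2)] by blast
    ultimately show ?thesis
      using v[OF that] \<open>v (z0, cnj z0) = c\<close> by (intro exI[of _ p] exI[of _ q]) simp
  qed
  ultimately show ?thesis unfolding integral_branch_def by blast
qed

theorem theorem2:
  fixes \<Gamma> U :: "complex set" and N :: "(complex \<times> complex) set"
    and \<phi> u1 u2 :: "complex \<Rightarrow> complex" and u :: "complex \<times> complex \<Rightarrow> complex"
    and z0 :: complex
  assumes arc: "unit_circle_arc \<Gamma>"
    and cont: "holomorphically_continuable \<Gamma> \<phi>"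
    and dirichlet: "dirichlet_solution \<Gamma> \<phi> u"
    and U: "open U" "connected U" "\<Gamma> \<subseteq> U" "0 \<notin> U" "z0 \<in> U"
    and u1: "u1 holomorphic_on U" and u2: "u2 holomorphic_on (cnj ` U)"
    and N: "open N" "real_points \<Gamma> \<subseteq> N"
    and decomp: "\<And>z \<zeta>. (z, \<zeta>) \<in> N \<Longrightarrow> u (z, \<zeta>) = u1 z + u2 \<zeta>"
  shows "(\<forall>W v. open W \<longrightarrow> real_points \<Gamma> \<subseteq> W \<longrightarrow> integral_branch U u1 u2 z0 W v \<longrightarrow>
            neumann_solution \<Gamma> \<phi> v) \<and>
         (\<Gamma> \<noteq> sphere 0 1 \<longrightarrow>
            (\<forall>c. \<exists>W v. open W \<and> real_points \<Gamma> \<subseteq> W \<and> integral_branch U u1 u2 z0 W v \<and>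
                   v (z0, cnj z0) = c))"
proof (intro conjI allI impI)
  fix W v assume W: "open W" "real_points \<Gamma> \<subseteq> W" and v: "integral_branch U u1 u2 z0 W v"
  have "u1 z + u2 (cnj z) = \<phi> z" if "z \<in> \<Gamma>" for z
  proof -
    have "(z, cnj z) \<in> N" using that N(2) by (auto simp: real_points_def)
    then show ?thesis using decomp dirichlet that by (metis dirichlet_solution_def)
  qed
  then show "neumann_solution \<Gamma> \<phi> v"
    using integral_branch_neumann_solution[OF U(1,4) u1 u2 W v U(3)] by blast
next
  \<comment> \<open>On the whole circle periods can prevent a branch: for \<open>u1 = 1\<close> and
    \<open>u2 = 0\<close> it would be a continuous logarithm around the circle up to a constant. A
    proper arc avoids this.\<close>
  fix c assume proper: "\<Gamma> \<noteq> sphere 0 1"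
  obtain T :: "real set" where T: "is_interval T" "\<Gamma> = cis ` T"
    using arc unfolding unit_circle_arc_def by blast
  have "connected \<Gamma>"
    unfolding T(2) using T(1)
    by (intro connected_continuous_image continuous_intros) (simp add: is_interval_connected_1)
  moreover have "\<Gamma> \<subset> sphere 0 1" using proper T(2) by (auto simp: psubset_eq)
  ultimately obtain S where S: "open S" "simply_connected S" "\<Gamma> \<subseteq> S" "S \<subseteq> U"
    using proper_circle_subset_neighborhood U(1,3) by metis
  obtain v where "integral_branch U u1 u2 z0 (S \<times> cnj ` S) v" "v (z0, cnj z0) = c"
    using integral_branch_exists[OF U(1,2,4,5) u1 u2 S(1,2,4)] by blast
  moreover have "open (S \<times> cnj ` S)" using S(1) open_cnj_image by (simp add: open_Times)
  moreover have "real_points \<Gamma> \<subseteq> S \<times> cnj ` S" using S(3) by (auto simp: real_points_def)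
  ultimately show "\<exists>W v. open W \<and> real_points \<Gamma> \<subseteq> W \<and> integral_branch U u1 u2 z0 W v \<and>
      v (z0, cnj z0) = c" by blast
qed

end
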